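(* Let $E:\mathbb{R}^n\to\mathbb{R}^n$ be one-to-one and onto, let $\eta:\mathbb{R}^n\times\mathbb{R}^n\to\mathbb{R}^n$, and consider the multiobjective problem (VP) of minimizing $f=(f_1,\dots,f_p)$ subject to $g_k(x)\leq 0$ ($k\in K$) and $h_j(x)=0$ ($j\in J$), with all functions $\mathbb{R}^n\to\mathbb{R}$ and $E$-differentiable on $\mathbb{R}^n$, with feasible set $\Omega$, and with $\Omega_E=\{x\in\mathbb{R}^n: E(x)\in\Omega\}$. Let $(E(\overline{y}),\overline{\tau},\overline{\rho},\overline{\xi})\in\Omega\times\mathbb{R}^p\times\mathbb{R}^m\times\mathbb{R}^q$ be an $E$-Karush-Kuhn-Tucker point of (VP). Let $K(E(\overline{y}))=\{k\in K: g_k(E(\overline{y}))=0\}$, $J^+(E(\overline{y}))=\{j\in J:\overline{\xi}_j>0\}$ and $J^-(E(\overline{y}))=\{j\in J:\overline{\xi}_j<0\}$. Assume that, with respect to the map $\eta$: (a) each $f_i$, $i\in I$, is exponentially $E$-invex at $\overline{y}$ on $\Omega_E$; (b) each $g_k$, $k\in K(E(\overline{y}))$, is exponentially $E$-invex at $\overline{y}$ on $\Omega_E$; (c) each $h_j$, $j\in J^+(E(\overline{y}))$, is exponentially $E$-invex at $\overline{y}$ on $\Omega_E$; (d) each $-h_j$, $j\in J^-(E(\overline{y}))$, is exponentially $E$-invex at $\overline{y}$ on $\Omega_E$. Then $E(\overline{y})$ is a weak $E$-Pareto solution of (VP).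
   Context: Index sets: $I=\{1,\dots,p\}$, $K=\{1,\dots,m\}$, $J=\{1,\dots,q\}$. The feasible set is $\Omega=\{x\in\mathbb{R}^n: g_k(x)\leq 0\ (k\in K),\ h_j(x)=0\ (j\in J)\}$. A function $\phi:\mathbb{R}^n\to\mathbb{R}$ is $E$-differentiable at $x_0$ if $\phi\circ E$ is differentiable at $x_0$ in the usual sense. Gradients are row vectors, so the product with a vector of $\mathbb{R}^n$ is the inner product. $(E(\overline{y}),\overline{\tau},\overline{\rho},\overline{\xi})\in\Omega\times\mathbb{R}^p\times\mathbb{R}^m\times\mathbb{R}^q$ is an $E$-Karush-Kuhn-Tucker point of (VP) if $$\sum_{i=1}^p\overline{\tau}_i\nabla(f_i\circ E)(\overline{y})+\sum_{k=1}^m\overline{\rho}_k\nabla(g_k\circ E)(\overline{y})+\sum_{j=1}^q\overline{\xi}_j\nabla(h_j\circ E)(\overline{y})=0,$$ $\overline{\rho}_k\,g_k(E(\overline{y}))=0$ for all $k\in K$, $\overline{\tau}_i\geq 0$ for all $i\in I$ with $\overline{\tau}\neq 0$, and $\overline{\rho}_k\geq0$ for all $k\in K$. An $E$-differentiable function $\phi$ is exponentially $E$-invex at $\overline{y}$ on $\Omega_E$ (with respect to $\eta$) if for all $x\in\Omega_E$, $$e^{\phi(E(x))}-e^{\phi(E(\overline{y}))}\geq\nabla(\phi\circ E)(\overline{y})\,e^{\phi(E(\overline{y}))}\,\eta(E(x),E(\overline{y})).$$ A point $E(\overline{y})\in\Omega$ is a weak $E$-Pareto solution of (VP) if there is no $E(x)\in\Omega$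 with $f_i(E(x))<f_i(E(\overline{y}))$ for all $i\in I$. *)

theory Defs
  imports "HOL-Analysis.Analysis"
begin

definition grad :: "('a::euclidean_space \<Rightarrow> real) \<Rightarrow> 'a \<Rightarrow> 'a" where
  "grad \<phi> x = (THE D. GDERIV \<phi> x :> D)"

lemma GDERIV_unique:
  fixes \<phi> :: "'a::euclidean_space \<Rightarrow> real"
  assumes "GDERIV \<phi> x :> D" "GDERIV \<phi> x :> D'"
  shows "D = D'"
proof -
  have "(\<lambda>h. h \<bullet> D) = (\<lambda>h. h \<bullet> D')"
    using has_derivative_unique assms unfolding gderiv_def by blast
  then show ?thesis
    by (metis vector_eq_ldot)
qed

lemma grad_eqI: "GDERIV \<phi> x :> D \<Longrightarrow> grad \<phi> x = D"
  unfolding grad_def using GDERIV_unique by blast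

lemma GDERIV_grad:
  fixes \<phi> :: "'a::euclidean_space \<Rightarrow> real"
  assumes "\<phi> differentiable (at x)"
  shows "GDERIV \<phi> x :> grad \<phi> x"
proof -
  obtain \<phi>' where d: "(\<phi> has_derivative \<phi>') (at x)"
    using assms unfolding differentiable_def by blast
  then have "linear \<phi>'"
    by (rule has_derivative_linear)
  then have "\<phi>' = (\<lambda>h. h \<bullet> adjoint \<phi>' 1)"
    by (auto simp: adjoint_works)
  with d have "GDERIV \<phi> x :> adjoint \<phi>' 1"
    unfolding gderiv_def by simp
  then show ?thesis
    using grad_eqI by metis
qed

definition E_differentiable_at ::
  "(real ^ 'n \<Rightarrow> real ^ 'n) \<Rightarrow> (real ^ 'n \<Rightarrow> real) \<Rightarrow> real ^ 'n \<Rightarrow> bool" where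
  "E_differentiable_at E \<phi> x \<longleftrightarrow> (\<phi> \<circ> E) differentiable (at x)"

text \<open>
  The data of (VP) are families indexed by \<open>{1..p}\<close>, \<open>{1..m}\<close> and \<open>{1..q}\<close>; they are
  represented by functions on \<^typ>\<open>nat\<close> whose values outside these ranges are irrelevant.
  The same holds for the multiplier vectors, so \<open>\<tau> \<noteq> 0\<close> means that some component with
  index in \<open>{1..p}\<close> is nonzero.
\<close>

definition feasible ::
  "nat \<Rightarrow> (nat \<Rightarrow> real ^ 'n \<Rightarrow> real) \<Rightarrow> nat \<Rightarrow> (nat \<Rightarrow> real ^ 'n \<Rightarrow> real) \<Rightarrow> (real ^ 'n) set" where
  "feasible m g q h = {x. (\<forall>k\<in>{1..m}. g k x \<le> 0) \<and> (\<forall>j\<in>{1..q}. h j x = 0)}"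

definition E_KKT_point ::
  "(real ^ 'n \<Rightarrow> real ^ 'n) \<Rightarrow> nat \<Rightarrow> (nat \<Rightarrow> real ^ 'n \<Rightarrow> real) \<Rightarrow>
   nat \<Rightarrow> (nat \<Rightarrow> real ^ 'n \<Rightarrow> real) \<Rightarrow> nat \<Rightarrow> (nat \<Rightarrow> real ^ 'n \<Rightarrow> real) \<Rightarrow>
   real ^ 'n \<Rightarrow> (nat \<Rightarrow> real) \<Rightarrow> (nat \<Rightarrow> real) \<Rightarrow> (nat \<Rightarrow> real) \<Rightarrow> bool" where
  "E_KKT_point E p f m g q h y \<tau> \<rho> \<xi> \<longleftrightarrow>
     E y \<in> feasible m g q h \<and>
     (\<Sum>i=1..p. \<tau> i *\<^sub>R grad (f i \<circ> E) y)
       + (\<Sum>k=1..m. \<rho> k *\<^sub>R grad (g k \<circ> E) y)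
       + (\<Sum>j=1..q. \<xi> j *\<^sub>R grad (h j \<circ> E) y) = 0 \<and>
     (\<forall>k\<in>{1..m}. \<rho> k * g k (E y) = 0) \<and>
     (\<forall>i\<in>{1..p}. \<tau> i \<ge> 0) \<and> (\<exists>i\<in>{1..p}. \<tau> i \<noteq> 0) \<and>
     (\<forall>k\<in>{1..m}. \<rho> k \<ge> 0)"

definition exp_E_invex_at ::
  "(real ^ 'n \<Rightarrow> real ^ 'n) \<Rightarrow> (real ^ 'n \<Rightarrow> real ^ 'n \<Rightarrow> real ^ 'n) \<Rightarrow>
   (real ^ 'n \<Rightarrow> real) \<Rightarrow> real ^ 'n \<Rightarrow> (real ^ 'n) set \<Rightarrow> bool" where
  "exp_E_invex_at E \<eta> \<phi> y S \<longleftrightarrow>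
     (\<forall>x. E_differentiable_at E \<phi> x) \<and>
     (\<forall>x\<in>S. exp (\<phi> (E x)) - exp (\<phi> (E y))
        \<ge> (exp (\<phi> (E y)) *\<^sub>R grad (\<phi> \<circ> E) y) \<bullet> \<eta> (E x) (E y))"

definition weak_E_Pareto ::
  "(real ^ 'n \<Rightarrow> real ^ 'n) \<Rightarrow> nat \<Rightarrow> (nat \<Rightarrow> real ^ 'n \<Rightarrow> real) \<Rightarrow>
   nat \<Rightarrow> (nat \<Rightarrow> real ^ 'n \<Rightarrow> real) \<Rightarrow> nat \<Rightarrow> (nat \<Rightarrow> real ^ 'n \<Rightarrow> real) \<Rightarrow>
   real ^ 'n \<Rightarrow> bool" where
  "weak_E_Pareto E p f m g q h y \<longleftrightarrow>
     E y \<in> feasible m g q h \<and>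
     \<not> (\<exists>x. E x \<in> feasible m g q h \<and> (\<forall>i\<in>{1..p}. f i (E x) < f i (E y)))"

end

theory Submission
  imports Defs
begin

text \<open>
  At a feasible \<open>E x\<close> at which every objective is smaller than at \<open>E y\<close>, exponential invexity
  makes the gradients of all objectives pair negatively with \<open>\<eta> (E x) (E y)\<close>, those of the active
  inequality constraints nonpositively, and, since each \<open>h\<^sub>j\<close> vanishes at both points, those of the
  equality constraints with the sign opposite to that of their multipliers. The inner product
  of the stationarity equation with \<open>\<eta> (E x) (E y)\<close> would then be negative.
\<close>

text \<open>Monotonicity of \<open>exp\<close> makes the left side of the invexity inequality
  nonpositive, and the factor \<open>exp (\<phi> (E y))\<close> on the right is positive, so the
  sign passes to the inner product.\<close>

lemma exp_E_invex_at_grad_nonpos: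
  assumes "exp_E_invex_at E \<eta> \<phi> y S" "x \<in> S" "\<phi> (E x) \<le> \<phi> (E y)"
  shows "grad (\<phi> \<circ> E) y \<bullet> \<eta> (E x) (E y) \<le> 0"
proof -
  have "exp (\<phi> (E y)) * (grad (\<phi> \<circ> E) y \<bullet> \<eta> (E x) (E y)) \<le> exp (\<phi> (E x)) - exp (\<phi> (E y))"
    using assms(1,2) unfolding exp_E_invex_at_def by simp
  also have "\<dots> \<le> 0"
    using assms(3) by simp
  finally show ?thesis
    by (simp add: mult_le_0_iff)
qed

text \<open>The same argument with strict monotonicity of \<open>exp\<close>; the objectives need
  this form, as the final contradiction rests on one strict inequality.\<close>

lemma exp_E_invex_at_grad_neg:
  assumes "exp_E_invex_at E \<eta> \<phi> y S" "x \<in> S" "\<phi> (E x) < \<phi> (E y)"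
  shows "grad (\<phi> \<circ> E) y \<bullet> \<eta> (E x) (E y) < 0"
proof -
  have "exp (\<phi> (E y)) * (grad (\<phi> \<circ> E) y \<bullet> \<eta> (E x) (E y)) \<le> exp (\<phi> (E x)) - exp (\<phi> (E y))"
    using assms(1,2) unfolding exp_E_invex_at_def by simp
  also have "\<dots> < 0"
    using assms(3) by simp
  finally show ?thesis
    by (simp add: mult_less_0_iff)
qed

text \<open>Translates invexity of \<open>- h j\<close> into a sign condition on the gradient of
  \<open>h j\<close> itself, which is what occurs in the stationarity equation.\<close>

lemma grad_uminus:
  fixes \<phi> :: "'a::euclidean_space \<Rightarrow> real"
  assumes "\<phi> differentiable (at x)"
  shows "grad (\<lambda>z. - \<phi> z) x = - grad \<phi> x"
  using GDERIV_minus[OF GDERIV_grad[OF assms]] by (rule grad_eqI)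

theorem theorem27:
  fixes E :: "real ^ 'n \<Rightarrow> real ^ 'n"
    and \<eta> :: "real ^ 'n \<Rightarrow> real ^ 'n \<Rightarrow> real ^ 'n"
    and p m q :: nat
    and f g h :: "nat \<Rightarrow> real ^ 'n \<Rightarrow> real"
    and y :: "real ^ 'n"
    and \<tau> \<rho> \<xi> :: "nat \<Rightarrow> real"
    and \<Omega>\<^sub>E :: "(real ^ 'n) set"
  defines "\<Omega>\<^sub>E \<equiv> {x. E x \<in> feasible m g q h}"
  assumes "bij E"
    and "\<forall>i\<in>{1..p}. \<forall>x. E_differentiable_at E (f i) x"
    and "\<forall>k\<in>{1..m}. \<forall>x. E_differentiable_at E (g k) x"
    and "\<forall>j\<in>{1..q}. \<forall>x. E_differentiable_at E (h j) x"
    and "E_KKT_point E p f m g q h y \<tau> \<rho> \<xi>"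
    and "\<forall>i\<in>{1..p}. exp_E_invex_at E \<eta> (f i) y \<Omega>\<^sub>E"
    and "\<forall>k\<in>{k\<in>{1..m}. g k (E y) = 0}. exp_E_invex_at E \<eta> (g k) y \<Omega>\<^sub>E"
    and "\<forall>j\<in>{j\<in>{1..q}. \<xi> j > 0}. exp_E_invex_at E \<eta> (h j) y \<Omega>\<^sub>E"
    and "\<forall>j\<in>{j\<in>{1..q}. \<xi> j < 0}. exp_E_invex_at E \<eta> (\<lambda>x. - h j x) y \<Omega>\<^sub>E"
  shows "weak_E_Pareto E p f m g q h y"
proof -
  have feas: "E y \<in> feasible m g q h"
    and stat: "(\<Sum>i=1..p. \<tau> i *\<^sub>R grad (f i \<circ> E) y)
       + (\<Sum>k=1..m. \<rho> k *\<^sub>R grad (g k \<circ> E) y)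
       + (\<Sum>j=1..q. \<xi> j *\<^sub>R grad (h j \<circ> E) y) = 0"
    and compl: "\<forall>k\<in>{1..m}. \<rho> k * g k (E y) = 0"
    and \<tau>: "\<forall>i\<in>{1..p}. \<tau> i \<ge> 0" "\<exists>i\<in>{1..p}. \<tau> i \<noteq> 0"
    and \<rho>: "\<forall>k\<in>{1..m}. \<rho> k \<ge> 0"
    using assms(6) unfolding E_KKT_point_def by auto
  have False if x: "E x \<in> feasible m g q h" and less: "\<forall>i\<in>{1..p}. f i (E x) < f i (E y)" for x
  proof -
    define v where "v = \<eta> (E x) (E y)"
    have x\<Omega>: "x \<in> \<Omega>\<^sub>E"
      using x by (simp add: assms(1))
    have f_neg: "grad (f i \<circ> E) y \<bullet> v < 0" if "i \<in> {1..p}" for i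
      using exp_E_invex_at_grad_neg[OF _ x\<Omega>] assms(7) less that unfolding v_def by blast
    \<comment> \<open>A nonzero multiplier that is nonnegative is positive; its term makes the sum
      over the objectives strictly negative.\<close>
    obtain i\<^sub>0 where i\<^sub>0: "i\<^sub>0 \<in> {1..p}" "\<tau> i\<^sub>0 > 0"
      using \<tau> by force
    have "(\<Sum>i=1..p. \<tau> i * (grad (f i \<circ> E) y \<bullet> v)) < (\<Sum>i=1..p. 0)"
    proof (rule sum_strict_mono_ex1)
      show "\<forall>i\<in>{1..p}. \<tau> i * (grad (f i \<circ> E) y \<bullet> v) \<le> 0"
        using \<tau>(1) f_neg by (simp add: mult_nonneg_nonpos less_imp_le)
      show "\<exists>i\<in>{1..p}. \<tau> i * (grad (f i \<circ> E) y \<bullet> v) < 0"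
        using i\<^sub>0 f_neg by (blast intro: mult_pos_neg)
    qed simp
    moreover have "(\<Sum>k=1..m. \<rho> k * (grad (g k \<circ> E) y \<bullet> v)) \<le> 0"
    proof (rule sum_nonpos)
      fix k assume k: "k \<in> {1..m}"
      show "\<rho> k * (grad (g k \<circ> E) y \<bullet> v) \<le> 0"
      \<comment> \<open>Invexity is available for active constraints only; for inactive ones
        complementary slackness removes the term.\<close>
      proof (cases "g k (E y) = 0")
        case True
        then have "g k (E x) \<le> g k (E y)"
          using x k by (simp add: feasible_def)
        then have "grad (g k \<circ> E) y \<bullet> v \<le> 0"
          using exp_E_invex_at_grad_nonpos[OF _ x\<Omega>] assms(8) k True unfolding v_def by blast
        then show ?thesis
          using \<rho> k by (simp add: mult_nonneg_nonpos)
      next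
        case False
        then have "\<rho> k = 0"
          using compl k mult_eq_0_iff by blast
        then show ?thesis
          by simp
      qed
    qed
    moreover have "(\<Sum>j=1..q. \<xi> j * (grad (h j \<circ> E) y \<bullet> v)) \<le> 0"
    proof (rule sum_nonpos)
      fix j assume j: "j \<in> {1..q}"
      \<comment> \<open>Equality lets the nonpositivity lemma apply to \<open>h j\<close> and to
        \<open>- h j\<close> alike.\<close>
      have eq: "h j (E x) = h j (E y)"
        using x feas j by (simp add: feasible_def)
      consider "\<xi> j > 0" | "\<xi> j = 0" | "\<xi> j < 0"
        by linarith
      then show "\<xi> j * (grad (h j \<circ> E) y \<bullet> v) \<le> 0"
      proof cases
        case 1
        then have "grad (h j \<circ> E) y \<bullet> v \<le> 0"
          using exp_E_invex_at_grad_nonpos[OF _ x\<Omega>, of E \<eta> "h j"] assms(9) j eq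
          unfolding v_def by simp
        then show ?thesis
          using 1 by (simp add: mult_nonneg_nonpos)
      next
        \<comment> \<open>The gradient of \<open>- h j\<close> pairs nonpositively with
          \<open>v\<close>, so that of \<open>h j\<close> pairs nonnegatively, and the negative
          multiplier reverses the sign again.\<close>
        case 3
        then have "grad ((\<lambda>x. - h j x) \<circ> E) y \<bullet> v \<le> 0"
          using exp_E_invex_at_grad_nonpos[OF _ x\<Omega>, of E \<eta> "\<lambda>x. - h j x"] assms(10) j eq
          unfolding v_def by simp
        moreover have "grad ((\<lambda>x. - h j x) \<circ> E) y = - grad (h j \<circ> E) y"
          using grad_uminus[of "h j \<circ> E" y] assms(5) j
          by (simp add: E_differentiable_at_def comp_def)
        ultimately show ?thesis
          using 3 by (simp add: mult_nonpos_nonneg)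
      qed simp
    qed
    moreover have "(\<Sum>i=1..p. \<tau> i * (grad (f i \<circ> E) y \<bullet> v))
       + (\<Sum>k=1..m. \<rho> k * (grad (g k \<circ> E) y \<bullet> v))
       + (\<Sum>j=1..q. \<xi> j * (grad (h j \<circ> E) y \<bullet> v)) = 0"
      \<comment> \<open>Pairing the stationarity equation with \<open>v\<close> gives zero, whereas
        the three bounds above make the same sum negative.\<close>
      using arg_cong[OF stat, of "\<lambda>u. u \<bullet> v"] by (simp add: inner_add_left inner_sum_left)
    ultimately show False
      by simp
  qed
  with feas show ?thesis
    unfolding weak_E_Pareto_def by blast
qed

end
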